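(* Let $\alpha>-\frac12$. For every $f\in\mathcal{D}(\mathbb{R})$, $$\mathcal{F}_{B,S}^\alpha(f)=\mathcal{F}\circ W_\alpha(f).$$
   Context: $\mathcal{D}(\mathbb{R})$ is the space of infinitely differentiable (complex-valued) functions on $\mathbb{R}$ with compact support. For $\alpha>-\frac12$, the Bessel-Struve kernel is $S_\lambda^\alpha(x)=\frac{2\Gamma(\alpha+1)}{\sqrt\pi\,\Gamma(\alpha+\frac12)}\int_0^1(1-t^2)^{\alpha-\frac12}e^{\lambda xt}\,dt$ ($\lambda\in\mathbb{C}$, $x\in\mathbb{R}$), and the Bessel-Struve transform is $\mathcal{F}_{B,S}^\alpha(f)(\lambda)=\int_{\mathbb{R}}f(x)\,S_{-i\lambda}^\alpha(x)\,|x|^{2\alpha+1}dx$, $\lambda\in\mathbb{R}$. The Weyl integral associated to the Bessel-Struve operator is $$W_\alpha f(y)=\frac{2\Gamma(\alpha+1)}{\sqrt{\pi}\,\Gamma(\alpha+\frac12)}\int_{|y|}^{+\infty}(x^2-y^2)^{\alpha-\frac12}\,x\,f(\mathrm{sgn}(y)x)\,dx,\qquad y\in\mathbb{R}\setminus\{0\}.$$ $\mathcal{F}$ is the classical Fourier transform on $L^1(\mathbb{R})$: $\mathcal{F}(g)(\lambda)=\int_{\mathbb{R}}g(x)e^{-i\lambda x}dx$. *)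

theory Defs
  imports "HOL-Analysis.Analysis"
begin

text \<open>The space $\mathcal{D}(\mathbb{R})$. Complex-valued functions of a real variable have no
  \<^const>\<open>deriv\<close>, so the iterated derivatives are iterated vector derivatives; requiring each
  of them to be differentiable everywhere is infinite differentiability.\<close>

definition test_functions :: "(real \<Rightarrow> complex) set" where
  "test_functions =
     {f. (\<forall>n x. ((\<lambda>g t. vector_derivative g (at t)) ^^ n) f differentiable (at x))
         \<and> compact (closure {x. f x \<noteq> 0})}"

definition bessel_struve_const :: "real \<Rightarrow> real" where
  "bessel_struve_const \<alpha> = 2 * Gamma (\<alpha> + 1) / (sqrt pi * Gamma (\<alpha> + 1/2))"

definition bessel_struve_kernel :: "real \<Rightarrow> complex \<Rightarrow> real \<Rightarrow> complex" where
  "bessel_struve_kernel \<alpha> l x =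
     of_real (bessel_struve_const \<alpha>) *
     (LBINT t:{0..1}. of_real ((1 - t\<^sup>2) powr (\<alpha> - 1/2)) * exp (l * of_real x * of_real t))"

definition bessel_struve_transform :: "real \<Rightarrow> (real \<Rightarrow> complex) \<Rightarrow> real \<Rightarrow> complex" where
  "bessel_struve_transform \<alpha> f l =
     (LBINT x. f x * bessel_struve_kernel \<alpha> (- \<i> * of_real l) x
               * of_real (\<bar>x\<bar> powr (2 * \<alpha> + 1)))"

text \<open>The Weyl integral is only meant for \<open>y \<noteq> 0\<close>; the value that the formula below assigns at
  \<open>y = 0\<close> is irrelevant, since the function is only ever integrated.\<close>

definition weyl_integral :: "real \<Rightarrow> (real \<Rightarrow> complex) \<Rightarrow> real \<Rightarrow> complex" where
  "weyl_integral \<alpha> f y =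
     of_real (bessel_struve_const \<alpha>) *
     (LBINT x:{\<bar>y\<bar>..}. of_real ((x\<^sup>2 - y\<^sup>2) powr (\<alpha> - 1/2) * x) * f (sgn y * x))"

definition fourier_transform :: "(real \<Rightarrow> complex) \<Rightarrow> real \<Rightarrow> complex" where
  "fourier_transform g l = (LBINT x. g x * exp (- \<i> * of_real l * of_real x))"

end

theory Submission
  imports Defs
begin

text \<open>Both sides are iterated integrals, in the two possible orders, of the function
  \<open>(x, y) \<mapsto> (x\<^sup>2 - y\<^sup>2) powr (\<alpha> - 1/2) * \<bar>x\<bar> * f x * exp (-\<i> l y)\<close> over the double cone
  \<open>\<bar>y\<bar> \<le> \<bar>x\<bar>\<close>, \<open>x y \<ge> 0\<close>. For fixed \<open>x\<close> the substitution \<open>y = x t\<close> produces the Bessel-Struve kernel; for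
  fixed \<open>y \<noteq> 0\<close> the substitution \<open>x \<mapsto> sgn y x\<close> produces the Weyl integral. Fubini's theorem applies
  since \<open>(1 - t\<^sup>2) powr (\<alpha> - 1/2)\<close> is integrable on \<open>[0, 1]\<close> and \<open>\<bar>x\<bar> powr (2 \<alpha> + 1) * f x\<close> is continuous
  with compact support.\<close>

definition cone_integrand :: "real \<Rightarrow> (real \<Rightarrow> complex) \<Rightarrow> real \<Rightarrow> real \<Rightarrow> real \<Rightarrow> complex" where
  "cone_integrand \<alpha> f l x y =
     (if \<bar>y\<bar> \<le> \<bar>x\<bar> \<and> 0 \<le> x * y
      then of_real ((x\<^sup>2 - y\<^sup>2) powr (\<alpha> - 1/2) * \<bar>x\<bar>) * f x * exp (- \<i> * of_real l * of_real y)
      else 0)"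

lemma measurable_cone_integrand [measurable]:
  assumes [measurable]: "f \<in> borel_measurable borel"
  shows "(\<lambda>(x, y). cone_integrand \<alpha> f l x y) \<in> borel_measurable (borel \<Otimes>\<^sub>M borel)"
  unfolding cone_integrand_def by measurable

lemma test_functions_continuous:
  assumes "f \<in> test_functions"
  shows "continuous_on UNIV f"
proof -
  have "f differentiable (at x)" for x
    using assms unfolding test_functions_def
    by (metis (mono_tags, lifting) funpow_0 mem_Collect_eq)
  then show ?thesis
    by (simp add: continuous_at_imp_continuous_on differentiable_imp_continuous_within)
qed

lemma test_functions_integrable_powr:
  assumes "f \<in> test_functions" and "p > 0"
  shows "integrable lborel (\<lambda>x. of_real (\<bar>x\<bar> powr p) * f x)"
proof -
  let ?K = "closure {x. f x \<noteq> 0}"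
  \<comment> \<open>Continuity at the origin comes from p > 0. In the application p is 2 \<alpha> +
    1, so this is one of the two places where \<alpha> > -1/2 matters; the other is the singularity
    of the kernel at t = 1.\<close>
  have "continuous_on ?K (\<lambda>x. of_real (\<bar>x\<bar> powr p) * f x)"
    using \<open>p > 0\<close>
    by (intro continuous_intros continuous_on_powr' continuous_on_subset[OF test_functions_continuous[OF assms(1)]])
      auto
  moreover have "compact ?K"
    using assms by (simp add: test_functions_def)
  ultimately have "integrable lborel (\<lambda>x. indicator ?K x *\<^sub>R (of_real (\<bar>x\<bar> powr p) * f x))"
    by (rule borel_integrable_compact[rotated])
  moreover have "indicator ?K x *\<^sub>R (of_real (\<bar>x\<bar> powr p) * f x) = of_real (\<bar>x\<bar> powr p) * f x" for x
    using closure_subset[of "{x. f x \<noteq> 0}"] by (auto simp: indicator_def)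
  ultimately show ?thesis by simp
qed

text \<open>Factor 1 - t^2 as (1 + t) (1 - t). On [0, 1] the power of 1 + t is bounded by
  \<open>max 1 (2 powr p)\<close>, whatever the sign of p, and the power of 1 - t is the Beta
  integrand with parameters 1 and p + 1.\<close>

lemma set_integrable_one_minus_square_powr:
  fixes p :: real
  assumes "p > -1"
  shows "set_integrable lborel {0..1} (\<lambda>t. (1 - t\<^sup>2) powr p)"
proof -
  have "set_integrable lborel {0..1::real} (\<lambda>t. t powr (1 - 1) * (1 - t) powr ((p + 1) - 1))"
    using assms by (intro integrable_Beta) auto
  then have *: "set_integrable lborel {0..1::real} (\<lambda>t. max 1 (2 powr p) * (t powr 0 * (1 - t) powr p))"
    by (intro set_integrable_mult_right) auto
  show ?thesis
  proof (rule set_integrable_bound[OF *])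
    show "set_borel_measurable lborel {0..1} (\<lambda>t. (1 - t\<^sup>2) powr p)"
      unfolding set_borel_measurable_def by measurable
    \<comment> \<open>The point 0 is left out because \<open>0 powr 0 = 0\<close> makes the
      dominating function vanish there; being a null set, it is harmless.\<close>
    have "(1 - t\<^sup>2) powr p \<le> max 1 (2 powr p) * (t powr 0 * (1 - t) powr p)"
      if "t \<in> {0..1}" "t \<noteq> 0" for t :: real
    proof -
      have "(1 - t\<^sup>2) powr p = (1 + t) powr p * (1 - t) powr p"
        using that by (subst powr_mult[symmetric]) (auto simp: algebra_simps power2_eq_square)
      moreover have "(1 + t) powr p \<le> max 1 (2 powr p)"
      proof (cases "p \<ge> 0")
        case True
        then have "(1 + t) powr p \<le> 2 powr p" using that by (intro powr_mono2) auto
        then show ?thesis by simp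
      next
        case False
        then have "(1 + t) powr p \<le> 1 powr p" using that by (intro powr_mono2') auto
        then show ?thesis by simp
      qed
      ultimately show ?thesis using that by (simp add: mult_right_mono)
    qed
    then show "AE t in lborel. t \<in> {0..1} \<longrightarrow>
        norm ((1 - t\<^sup>2) powr p) \<le> norm (max 1 (2 powr p) * (t powr 0 * (1 - t) powr p))"
      using AE_lborel_singleton[of "0::real"] by (auto elim!: eventually_mono)
  qed
qed

text \<open>By homogeneity, x^2 - (x t)^2 = x^2 (1 - t^2), which releases \<bar>x\<bar> to the power
  2 \<alpha> - 1; the weight \<bar>x\<bar> raises this to 2 \<alpha>. For either sign of x the
  section of the cone becomes t in [0, 1].\<close>

lemma cone_integrand_scale:
  assumes "x \<noteq> 0"
  shows "cone_integrand \<alpha> f l x (x * t) =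
    of_real (\<bar>x\<bar> powr (2 * \<alpha>)) * f x *
      (indicator {0..1} t *\<^sub>R (of_real ((1 - t\<^sup>2) powr (\<alpha> - 1/2)) * exp (- \<i> * of_real l * of_real x * of_real t)))"
proof -
  have iff: "\<bar>x * t\<bar> \<le> \<bar>x\<bar> \<and> 0 \<le> x * (x * t) \<longleftrightarrow> t \<in> {0..1}"
  proof -
    have "0 \<le> x * (x * t) \<longleftrightarrow> 0 \<le> t"
      using assms by (auto simp: zero_le_mult_iff mult_le_0_iff)
    moreover have "\<bar>x * t\<bar> \<le> \<bar>x\<bar> \<longleftrightarrow> \<bar>t\<bar> \<le> 1"
      using assms by (simp add: abs_mult mult_le_cancel_left1)
    ultimately show ?thesis by auto
  qed
  show ?thesis
  proof (cases "t \<in> {0..1}")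
    case True
    have "x\<^sup>2 = \<bar>x\<bar> powr 2"
      using assms by (simp add: powr_numeral)
    then have x2: "x\<^sup>2 powr (\<alpha> - 1/2) = \<bar>x\<bar> powr (2 * \<alpha> - 1)"
      by (simp only: powr_powr) (simp add: algebra_simps)
    have "x\<^sup>2 - (x * t)\<^sup>2 = x\<^sup>2 * (1 - t\<^sup>2)"
      by (simp add: algebra_simps power_mult_distrib)
    then have "(x\<^sup>2 - (x * t)\<^sup>2) powr (\<alpha> - 1/2) * \<bar>x\<bar> =
        (\<bar>x\<bar> powr (2 * \<alpha> - 1) * \<bar>x\<bar> powr 1) * (1 - t\<^sup>2) powr (\<alpha> - 1/2)"
      using True by (simp add: powr_mult x2 power_le_one)
    also have "\<dots> = \<bar>x\<bar> powr (2 * \<alpha>) * (1 - t\<^sup>2) powr (\<alpha> - 1/2)"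
      by (subst powr_add[symmetric]) simp
    finally show ?thesis
      using True iff unfolding cone_integrand_def by (simp add: mult_ac)
  next
    case False
    then show ?thesis using iff unfolding cone_integrand_def by (auto simp: indicator_def)
  qed
qed

lemma abs_mult_abs_powr: "\<bar>x::real\<bar> * \<bar>x\<bar> powr p = \<bar>x\<bar> powr (p + 1)"
  by (cases "x = 0") (auto simp: powr_add)

lemma integrable_cone_integrand_scaled:
  assumes "\<alpha> > -1/2"
  shows "integrable lborel (\<lambda>t. indicator {0..1} t *\<^sub>R
    (of_real ((1 - t\<^sup>2) powr (\<alpha> - 1/2)) * exp (- \<i> * of_real l * of_real x * of_real t) :: complex))"
    (is "integrable _ ?g")
proof (rule Bochner_Integration.integrable_bound)
  show "integrable lborel (\<lambda>t. indicator {0..1} t *\<^sub>R (1 - t\<^sup>2) powr (\<alpha> - 1/2))"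
    using set_integrable_one_minus_square_powr[of "\<alpha> - 1/2"] assms by (simp add: set_integrable_def)
  show "?g \<in> borel_measurable lborel" by measurable
qed (auto simp: norm_mult)

lemma cone_integrand_zero_left: "cone_integrand \<alpha> f l 0 = (\<lambda>_. 0)"
  by (auto simp: cone_integrand_def)

lemma integrable_cone_integrand_right:
  assumes "\<alpha> > -1/2"
  shows "integrable lborel (cone_integrand \<alpha> f l x)"
proof (cases "x = 0")
  case False
  have "integrable lborel (\<lambda>t. cone_integrand \<alpha> f l x (0 + x * t))"
    unfolding add_0_left cone_integrand_scale[OF False]
    by (intro integrable_mult_right integrable_cone_integrand_scaled assms)
  then show ?thesis
    using lborel_integrable_real_affine_iff[OF False, of "cone_integrand \<alpha> f l x" 0] by simp
qed (simp add: cone_integrand_zero_left)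

text \<open>The Jacobian \<bar>x\<bar> of y = x t raises the exponent 2 \<alpha> of
  \<open>cone_integrand_scale\<close> to 2 \<alpha> + 1. At x = 0 both sides vanish, the right one
  because \<open>0 powr p = 0\<close>.\<close>

lemma integral_cone_integrand_right:
  "of_real (bessel_struve_const \<alpha>) * (LBINT y. cone_integrand \<alpha> f l x y) =
    f x * bessel_struve_kernel \<alpha> (- \<i> * of_real l) x * of_real (\<bar>x\<bar> powr (2 * \<alpha> + 1))"
proof (cases "x = 0")
  case False
  show ?thesis
    unfolding abs_mult_abs_powr[symmetric]
    by (subst lborel_integral_real_affine[OF False, where t = 0])
       (simp only: add_0_left cone_integrand_scale[OF False] integral_mult_right_zero,
        simp add: bessel_struve_kernel_def set_lebesgue_integral_def scaleR_conv_of_real mult_ac)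
qed (simp add: cone_integrand_zero_left)

text \<open>This is the inner integral in the integrability criterion of Fubini's theorem. The
  exponential has modulus 1, so the variables separate and only a constant multiple of the weighted
  norm of f remains to be integrated over x.\<close>

lemma integral_norm_cone_integrand_right:
  "(LBINT y. norm (cone_integrand \<alpha> f l x y)) =
    (LBINT t:{0..1}. (1 - t\<^sup>2) powr (\<alpha> - 1/2)) * norm (of_real (\<bar>x\<bar> powr (2 * \<alpha> + 1)) * f x)"
proof (cases "x = 0")
  case False
  show ?thesis
    unfolding abs_mult_abs_powr[symmetric]
    by (subst lborel_integral_real_affine[OF False, where t = 0])
       (simp only: add_0_left cone_integrand_scale[OF False] norm_mult integral_mult_right_zero,
        simp add: set_lebesgue_integral_def norm_mult mult_ac)
qed (simp add: cone_integrand_zero_left)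

text \<open>The map x \<mapsto> sgn y x preserves Lebesgue measure and carries the half line x \<ge>
  \<bar>y\<bar> onto the section of the cone at height y, since (sgn y x) y = x \<bar>y\<bar>. At y
  = 0 it would collapse to the zero map.\<close>

lemma integral_cone_integrand_left:
  assumes "y \<noteq> 0"
  shows "of_real (bessel_struve_const \<alpha>) * (LBINT x. cone_integrand \<alpha> f l x y) =
    weyl_integral \<alpha> f y * exp (- \<i> * of_real l * of_real y)"
proof -
  have sgn: "sgn y \<noteq> 0" "\<bar>sgn y\<bar> = 1" "(sgn y)\<^sup>2 = 1" "sgn y * y = \<bar>y\<bar>"
    using assms by (auto simp: sgn_if)
  have "cone_integrand \<alpha> f l (sgn y * x) y =
      (indicator {\<bar>y\<bar>..} x *\<^sub>R (of_real ((x\<^sup>2 - y\<^sup>2) powr (\<alpha> - 1/2) * x) * f (sgn y * x))) *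
      exp (- \<i> * of_real l * of_real y)" for x
  proof -
    have "\<bar>y\<bar> \<le> \<bar>x\<bar> \<and> 0 \<le> (sgn y * x) * y \<longleftrightarrow> \<bar>y\<bar> \<le> x"
      using assms by (auto simp: sgn_if zero_le_mult_iff mult_le_0_iff)
    then show ?thesis using assms
      by (auto simp: cone_integrand_def abs_mult sgn(2,3) power_mult_distrib indicator_def)
  qed
  then have "(LBINT x. cone_integrand \<alpha> f l x y) =
      (LBINT x:{\<bar>y\<bar>..}. of_real ((x\<^sup>2 - y\<^sup>2) powr (\<alpha> - 1/2) * x) * f (sgn y * x)) *
      exp (- \<i> * of_real l * of_real y)"
    by (subst lborel_integral_real_affine[OF sgn(1), where t = 0])
       (simp only: sgn(2) set_lebesgue_integral_def add_0_left integral_mult_left_zero scaleR_one)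
  then show ?thesis by (simp add: weyl_integral_def mult_ac)
qed

lemma measurable_weyl_integral [measurable]:
  assumes [measurable]: "f \<in> borel_measurable borel"
  shows "weyl_integral \<alpha> f \<in> borel_measurable borel"
proof -
  \<comment> \<open>Moving the domain, which depends on y, into the integrand gives a jointly
    measurable function of (x, y), so that the integral is measurable in the parameter y.\<close>
  have eq: "weyl_integral \<alpha> f = (\<lambda>y. of_real (bessel_struve_const \<alpha>) *
      (LBINT x. (if \<bar>y\<bar> \<le> x then of_real ((x\<^sup>2 - y\<^sup>2) powr (\<alpha> - 1/2) * x) * f (sgn y * x) else 0)))"
    unfolding weyl_integral_def set_lebesgue_integral_def
    by (intro ext arg_cong2[where f = "(*)"] Bochner_Integration.integral_cong) auto
  show ?thesis unfolding eq by measurable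
qed

lemma integrable_cone_integrand:
  assumes "\<alpha> > -1/2" and "f \<in> test_functions"
  shows "integrable (lborel \<Otimes>\<^sub>M lborel) (\<lambda>(x, y). cone_integrand \<alpha> f l x y)"
proof (rule lborel_pair.Fubini_integrable)
  have [measurable]: "f \<in> borel_measurable borel"
    using test_functions_continuous[OF assms(2)] by (rule borel_measurable_continuous_onI)
  show "(\<lambda>(x, y). cone_integrand \<alpha> f l x y) \<in> borel_measurable (lborel \<Otimes>\<^sub>M lborel)"
    by measurable
  show "integrable lborel (\<lambda>x. LBINT y. norm ((\<lambda>(x, y). cone_integrand \<alpha> f l x y) (x, y)))"
    using test_functions_integrable_powr[OF assms(2), of "2 * \<alpha> + 1"] assms(1)
    by (simp only: prod.case integral_norm_cone_integrand_right)
       (intro integrable_mult_right integrable_norm, simp)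
  show "AE x in lborel. integrable lborel (\<lambda>y. (\<lambda>(x, y). cone_integrand \<alpha> f l x y) (x, y))"
    using integrable_cone_integrand_right[OF assms(1)] by simp
qed

theorem proposition3p3:
  fixes \<alpha> :: real and f :: "real \<Rightarrow> complex"
  assumes "\<alpha> > -1/2" and "f \<in> test_functions"
  shows "integrable lborel (weyl_integral \<alpha> f) \<and>
         bessel_struve_transform \<alpha> f = fourier_transform (weyl_integral \<alpha> f)"
proof
  have [measurable]: "f \<in> borel_measurable borel"
    using test_functions_continuous[OF assms(2)] by (rule borel_measurable_continuous_onI)
  let ?c = "of_real (bessel_struve_const \<alpha>) :: complex"
  have int: "integrable lborel (\<lambda>y. ?c * (LBINT x. cone_integrand \<alpha> f l x y))" for l
    using lborel_pair.integrable_snd[OF integrable_cone_integrand[OF assms]]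
    by (intro integrable_mult_right)
  \<comment> \<open>The only exception is y = 0, a null set.\<close>
  have AE_eq: "AE y in lborel. ?c * (LBINT x. cone_integrand \<alpha> f l x y) =
      weyl_integral \<alpha> f y * exp (- \<i> * of_real l * of_real y)" for l
    using AE_lborel_singleton[of "0::real"]
    by eventually_elim (rule integral_cone_integrand_left)
  \<comment> \<open>At l = 0 the exponential is 1, so the Weyl integral itself agrees almost
    everywhere with a partial integral that Fubini's theorem shows to be integrable.\<close>
  show "integrable lborel (weyl_integral \<alpha> f)"
    using AE_eq[of 0] by (intro integrable_cong_AE_imp[OF int[of 0]]) (auto elim!: eventually_mono)
  show "bessel_struve_transform \<alpha> f = fourier_transform (weyl_integral \<alpha> f)"
  proof
    fix l
    have "bessel_struve_transform \<alpha> f l = (LBINT x. ?c * (LBINT y. cone_integrand \<alpha> f l x y))"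
      unfolding bessel_struve_transform_def integral_cone_integrand_right ..
    also have "\<dots> = (LBINT y. ?c * (LBINT x. cone_integrand \<alpha> f l x y))"
      using lborel_pair.Fubini_integral[OF integrable_cone_integrand[OF assms]] by simp
    also have "\<dots> = fourier_transform (weyl_integral \<alpha> f) l"
      unfolding fourier_transform_def
      using AE_eq by (intro integral_cong_AE borel_measurable_integrable[OF int]) auto
    finally show "bessel_struve_transform \<alpha> f l = fourier_transform (weyl_integral \<alpha> f) l" .
  qed
qed

end
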